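(* Let $N\in\mathbb{N}$ be a positive multiple of $4$. The equations $$\psi^{(i,j,k,l)}(\mathbf{b})=0,\qquad (i,j,k,l)\in S_1\cup S_2,$$ for the unknown $\mathbf{b}\in\mathbb{R}^{N/2}$ are $N/2-1$ linearly independent linear equations, and therefore they have a nontrivial solution $\mathbf{b}\neq 0$. Moreover, this nontrivial solution $\mathbf{b}$ also solves all the other equations in $S$, i.e. $\psi^{(i,j,k,l)}(\mathbf{b})=0$ for all $(i,j,k,l)\in S$.
   Context: Write $N_h=N/2-1$, $c_\alpha=\cos(\alpha\pi/N)$, $s_\alpha=\sin(\alpha\pi/N)$. For $(i,j,k,l)\in\mathbb{Z}^4$ and $\mathbf{b}=(b_1,\dots,b_{N/2})\in\mathbb{R}^{N/2}$ put $$\psi^{(i,j,k,l)}(\mathbf{b})=-\sum_{q=1}^{N/2}(-1)^q b_q f_q^{(i,j,k,l)},\qquad f_q^{(i,j,k,l)}=\begin{cases}c_{iq}c_{jq}c_{kq}c_{lq}&q\text{ odd},\\ s_{iq}s_{jq}s_{kq}s_{lq}&q\text{ even}.\end{cases}$$ The index sets are $S=\{(i,j,k,l)\in\mathbb{Z}^4\mid -N_h\le i\le j\le k\le l\le N_h,\ i+j+k+l=N\}$, $S_1=\{(0,n+1,N/2-n,N/2-1)\mid 1\le n\le N/4-1\}\subset S$, $S_2=\{(2-m,m,N/2-1,N/2-1)\mid m=1\text{ or }3\le m\le N/4+1\}\subset S$ ($n,m$ integers). The equations are called linearly independent if the linear functionals $\mathbf{b}\mapsto\psi^{(i,j,k,l)}(\mathbf{b})$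 on $\mathbb{R}^{N/2}$ are linearly independent. *)

theory Defs
  imports Complex_Main "HOL-Library.Function_Algebras"
begin

text \<open>
  Functions into \<open>\<real>\<close> as a real vector space; this yields the library notions
  \<open>fun_space.independent\<close>, \<open>fun_space.span\<close> etc. It is used for coordinate vectors
  \<open>nat \<Rightarrow> real\<close> as well as for functionals \<open>(nat \<Rightarrow> real) \<Rightarrow> real\<close>.
\<close>

definition fun_scale :: "real \<Rightarrow> ('v \<Rightarrow> real) \<Rightarrow> 'v \<Rightarrow> real"
  where "fun_scale a f = (\<lambda>v. a * f v)"

global_interpretation fun_space: vector_space "fun_scale :: real \<Rightarrow> ('v \<Rightarrow> real) \<Rightarrow> 'v \<Rightarrow> real"
  by unfold_locales (simp_all add: fun_scale_def fun_eq_iff algebra_simps)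

text \<open>
  \<open>\<real>\<^sup>d\<close> with coordinates numbered \<open>1, \<dots>, d\<close>, realised as the sequences that vanish at all
  other indices, so that the zero vector is the constant zero function.
\<close>

definition coord_space :: "nat \<Rightarrow> (nat \<Rightarrow> real) set"
  where "coord_space d = {b. \<forall>q. q \<notin> {1..d} \<longrightarrow> b q = 0}"

type_synonym quad = "int \<times> int \<times> int \<times> int"

definition cs :: "nat \<Rightarrow> int \<Rightarrow> real"
  where "cs N \<alpha> = cos (of_int \<alpha> * pi / real N)"

definition sn :: "nat \<Rightarrow> int \<Rightarrow> real"
  where "sn N \<alpha> = sin (of_int \<alpha> * pi / real N)"

definition fq :: "nat \<Rightarrow> quad \<Rightarrow> nat \<Rightarrow> real"
  where "fq N = (\<lambda>(i, j, k, l) q.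
    if odd q then cs N (i * int q) * cs N (j * int q) * cs N (k * int q) * cs N (l * int q)
    else sn N (i * int q) * sn N (j * int q) * sn N (k * int q) * sn N (l * int q))"

definition psi :: "nat \<Rightarrow> quad \<Rightarrow> (nat \<Rightarrow> real) \<Rightarrow> real"
  where "psi N t b = - (\<Sum>q = 1..N div 2. (- 1) ^ q * b q * fq N t q)"

text \<open>
  A functional on the subspace \<open>coord_space (N div 2)\<close> is represented by its extension by zero
  to all sequences, so that equality and linear relations between such functions are exactly
  those between the functionals on \<open>coord_space (N div 2)\<close>.
\<close>

definition psi_functional :: "nat \<Rightarrow> quad \<Rightarrow> (nat \<Rightarrow> real) \<Rightarrow> real"
  where "psi_functional N t = (\<lambda>b. if b \<in> coord_space (N div 2) then psi N t b else 0)"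

definition Nh :: "nat \<Rightarrow> int"
  where "Nh N = int N div 2 - 1"

definition S :: "nat \<Rightarrow> quad set"
  where "S N = {(i, j, k, l). - Nh N \<le> i \<and> i \<le> j \<and> j \<le> k \<and> k \<le> l \<and> l \<le> Nh N
    \<and> i + j + k + l = int N}"

definition S1 :: "nat \<Rightarrow> quad set"
  where "S1 N = {(0, n + 1, int N div 2 - n, int N div 2 - 1) | n. 1 \<le> n \<and> n \<le> int N div 4 - 1}"

definition S2 :: "nat \<Rightarrow> quad set"
  where "S2 N = {(2 - m, m, int N div 2 - 1, int N div 2 - 1) | m.
    m = 1 \<or> (3 \<le> m \<and> m \<le> int N div 4 + 1)}"

end

theory Submission
  imports Defs
begin

text \<open>
  Let \<open>M = N/2\<close> and \<open>A(x) = \<Sum>q. b q * cos (x q \<pi> / M)\<close>, which is even and \<open>2M\<close>-periodic. In terms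
  of \<open>a = M - i, b = M - j, c = M - k, d = M - l\<close>, with sum \<open>2M\<close>, product-to-sum formulas turn
  the equation for \<open>(i,j,k,l)\<close> into \<open>A(0) + A(a+b) + A(a+c) + A(a+d) = A(a) + A(b) + A(c) + A(d)\<close>.
  The equations in \<open>S1\<close> say that \<open>A(x) - A(M-x)\<close> is affine on \<open>[0, M]\<close>; together with those in
  \<open>S2\<close> they force all second differences of \<open>A\<close> on \<open>[1, 2M-1]\<close> to equal the one, \<open>\<gamma>\<close>, at \<open>1\<close>. Hence
  \<open>A(x) = A(0) - \<gamma> x (2M - x) / 2\<close> on \<open>[0, 2M]\<close>, and such an \<open>A\<close> satisfies every equation in \<open>S\<close>.
  If \<open>\<gamma> = 0\<close>, then \<open>A\<close> is constant and \<open>b = 0\<close> by orthogonality. So the \<open>M - 1\<close> equations together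
  with \<open>\<gamma> = 0\<close> have only the trivial solution, and counting unknowns gives independence.
\<close>

section \<open>Linear algebra: underdetermined systems and independence of functionals\<close>

text \<open>Elimination by induction on the equations: two independent solutions of the earlier
  equations have a nonzero combination that also solves the new one.\<close>

lemma homogeneous_system_nontrivial_solution:
  fixes F :: "'i \<Rightarrow> ('v \<Rightarrow> real) \<Rightarrow> real"
  assumes "finite I" "finite Q" "card I < card Q"
    and "\<And>i. i \<in> I \<Longrightarrow> Vector_Spaces.linear fun_scale (*) (F i)"
  shows "\<exists>b. (\<forall>q. q \<notin> Q \<longrightarrow> b q = 0) \<and> b \<noteq> 0 \<and> (\<forall>i\<in>I. F i b = 0)"
  using assms
proof (induction I arbitrary: Q rule: finite_induct)
  case empty
  then obtain q where "q \<in> Q" by fastforce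
  then show ?case
    by (intro exI[of _ "\<lambda>x. if x = q then 1 else 0"]) (auto simp: fun_eq_iff)
next
  case (insert i I)
  have lin: "Vector_Spaces.linear fun_scale (*) (F j)" if "j \<in> insert i I" for j
    using insert.prems that by blast
  have lin_I: "\<And>j. j \<in> I \<Longrightarrow> Vector_Spaces.linear fun_scale (*) (F j)"
    using lin by blast
  have "card I < card Q"
    using insert.prems insert.hyps by simp
  then obtain b1 where b1: "\<forall>q. q \<notin> Q \<longrightarrow> b1 q = 0" "b1 \<noteq> 0" "\<forall>j\<in>I. F j b1 = 0"
    using insert.IH[OF insert.prems(1) _ lin_I] by blast
  then obtain q where q: "b1 q \<noteq> 0" by (auto simp: fun_eq_iff)
  with b1 have "q \<in> Q" by blast
  \<comment> \<open>Forbidding \<open>q\<close> in the support of the second solution makes it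
    independent of \<open>b1\<close>.\<close>
  then have "card I < card (Q - {q})"
    using insert.prems insert.hyps by simp
  then obtain b2 where b2: "\<forall>x. x \<notin> Q - {q} \<longrightarrow> b2 x = 0" "b2 \<noteq> 0" "\<forall>j\<in>I. F j b2 = 0"
    using insert.IH[OF _ _ lin_I, of "Q - {q}"] insert.prems(1) by blast
  \<comment> \<open>The coefficients cancel \<open>F i\<close>; at \<open>q\<close> only the
    \<open>b1\<close> term survives.\<close>
  define b where "b = fun_scale (F i b1) b2 - fun_scale (F i b2) b1"
  have F_b: "F j b = F i b1 * F j b2 - F i b2 * F j b1" if "j \<in> insert i I" for j
    unfolding b_def
    by (simp add: module_hom.diff[OF module_hom_linearI[OF lin[OF that]]]
        module_hom.scale[OF module_hom_linearI[OF lin[OF that]]])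
  show ?case
  proof (cases "F i b2 = 0")
    case True
    with b2 show ?thesis by (intro exI[of _ b2]) auto
  next
    case False
    have "b q \<noteq> 0" using False q b2(1) by (simp add: b_def fun_scale_def)
    then have "b \<noteq> 0" by (auto simp: fun_eq_iff)
    moreover have "\<forall>x. x \<notin> Q \<longrightarrow> b x = 0"
      using b1(1) b2(1) by (simp add: b_def fun_scale_def)
    moreover have "\<forall>j\<in>insert i I. F j b = 0"
      using F_b b1(3) b2(3) by auto
    ultimately show ?thesis by blast
  qed
qed

text \<open>Evaluating a vanishing combination at the point that separates \<open>t\<close> isolates
  the coefficient of \<open>F t\<close>.\<close>

lemma independent_if_separated:
  fixes F :: "'i \<Rightarrow> 'v \<Rightarrow> real"
  assumes "finite T"
    and sep: "\<And>t. t \<in> T \<Longrightarrow> \<exists>b. F t b \<noteq> 0 \<and> (\<forall>s\<in>T - {t}. F s b = 0)"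
  shows "inj_on F T \<and> fun_space.independent (F ` T)"
proof
  show inj: "inj_on F T"
  proof (rule inj_onI, rule ccontr)
    fix s t assume "s \<in> T" "t \<in> T" "F s = F t" "s \<noteq> t"
    with sep[of t] show False by (metis DiffI singletonD)
  qed
  show "fun_space.independent (F ` T)"
  proof (rule fun_space.independent_if_scalars_zero)
    show "finite (F ` T)" using assms(1) by simp
    fix u x assume z: "(\<Sum>x\<in>F ` T. fun_scale (u x) x) = 0" and "x \<in> F ` T"
    then obtain t where t: "t \<in> T" "x = F t" by blast
    obtain b where b: "F t b \<noteq> 0" "\<forall>s\<in>T - {t}. F s b = 0" using sep t by blast
    have "0 = (\<Sum>s\<in>T. fun_scale (u (F s)) (F s)) b"
      using z by (simp add: sum.reindex[OF inj])
    also have "\<dots> = (\<Sum>s\<in>T. u (F s) * F s b)"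
      using assms(1) by (induction T rule: finite_induct) (auto simp: fun_scale_def)
    also have "\<dots> = u (F t) * F t b"
      using b(2) by (subst sum.remove[OF assms(1) t(1)]) simp
    finally show "u x = 0" using b(1) t by simp
  qed
qed

section \<open>Trigonometry: from the equations to values of a cosine sum\<close>

text \<open>Product-to-sum yields cosines of all sign combinations of the angles; as the total is a
  multiple of \<open>pi\<close>, each collapses to a doubled angle or a doubled pair sum.\<close>

lemma prod_cos_of_sum:
  fixes p r s t :: real
  assumes "p + r + s + t = of_int m * pi"
  shows "8 * (cos p * cos r * cos s * cos t) = (if even m then 1 else - 1) *
    (1 + cos (2*p) + cos (2*r) + cos (2*s) + cos (2*t)
       + cos (2*(p+r)) + cos (2*(p+s)) + cos (2*(p+t)))"
    and "8 * (sin p * sin r * sin s * sin t) = (if even m then 1 else - 1) *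
    (1 - cos (2*p) - cos (2*r) - cos (2*s) - cos (2*t)
       + cos (2*(p+r)) + cos (2*(p+s)) + cos (2*(p+t)))"
proof -
  define e :: real where "e = (if even m then 1 else - 1)"
  have "cos (of_int m * pi - x) = e * cos x" for x :: real
    using cos_npi_int[of m] sin_npi_int[of m] by (auto simp: cos_diff e_def mult.commute)
  moreover have "y = of_int m * pi - x \<or> y = - (of_int m * pi - x)"
    if "y + x = of_int m * pi \<or> x - y = of_int m * pi" for x y
    using that by linarith
  ultimately have reflect: "cos y = e * cos x"
    if "y + x = of_int m * pi \<or> x - y = of_int m * pi" for x y
    using that by (metis cos_minus)
  \<comment> \<open>For instance \<open>p + r + s - t = m pi - 2t\<close>, while
    \<open>p + r - s - t = 2(p+r) - m pi\<close>.\<close>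
  have c: "cos (p + r + s + t) = e * cos 0" "cos (p + r + s - t) = e * cos (2*t)"
    "cos (p + r - s + t) = e * cos (2*s)" "cos (p - r + s + t) = e * cos (2*r)"
    "cos (- p + r + s + t) = e * cos (2*p)"
    "cos (p + r - s - t) = e * cos (2*(p+r))"
    "cos (p - r + s - t) = e * cos (2*(p+s))"
    "cos (p - r - s + t) = e * cos (2*(p+t))"
    using assms by (auto intro!: reflect simp del: cos_zero)
  have "8 * (cos p * cos r * cos s * cos t) =
    cos (p + r + s + t) + cos (p + r + s - t) + cos (p + r - s + t) + cos (p - r + s + t)
    + cos (- p + r + s + t) + cos (p + r - s - t) + cos (p - r + s - t) + cos (p - r - s + t)"
    by (simp add: cos_add sin_add cos_diff sin_diff algebra_simps)
  then show "8 * (cos p * cos r * cos s * cos t) = (if even m then 1 else - 1) *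
    (1 + cos (2*p) + cos (2*r) + cos (2*s) + cos (2*t)
       + cos (2*(p+r)) + cos (2*(p+s)) + cos (2*(p+t)))"
    unfolding c cos_zero e_def by (simp add: algebra_simps)
  have "8 * (sin p * sin r * sin s * sin t) =
    cos (p + r + s + t) - cos (p + r + s - t) - cos (p + r - s + t) - cos (p - r + s + t)
    - cos (- p + r + s + t) + cos (p + r - s - t) + cos (p - r + s - t) + cos (p - r - s + t)"
    by (simp add: cos_add sin_add cos_diff sin_diff algebra_simps)
  then show "8 * (sin p * sin r * sin s * sin t) = (if even m then 1 else - 1) *
    (1 - cos (2*p) - cos (2*r) - cos (2*s) - cos (2*t)
       + cos (2*(p+r)) + cos (2*(p+s)) + cos (2*(p+t)))"
    unfolding c cos_zero e_def by (simp add: algebra_simps)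
qed

text \<open>This is the function \<open>A\<close> of the overview, restricted to integer
  arguments.\<close>

definition cos_sum :: "nat \<Rightarrow> (nat \<Rightarrow> real) \<Rightarrow> int \<Rightarrow> real"
  where "cos_sum M b x = (\<Sum>q = 1..M. b q * cos (of_int x * real q * pi / real M))"

lemma cos_period_reflect:
  assumes "M > 0"
  shows "cos (of_int (2 * int M - x) * real q * pi / real M) = cos (of_int x * real q * pi / real M)"
proof -
  have "of_int (2 * int M - x) * real q * pi / real M
      = of_int (int q) * (2 * pi) - of_int x * real q * pi / real M"
    using assms by (simp add: field_simps)
  then show ?thesis
    using cos_int_2pin[of "int q"] sin_int_2pin[of "int q"]
    by (simp add: cos_diff mult.commute mult.left_commute)
qed

lemma cos_half_period_reflect:
  assumes "M > 0"
  shows "cos (of_int (int M - x) * real q * pi / real M)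
    = (- 1) ^ q * cos (of_int x * real q * pi / real M)"
proof -
  have "of_int (int M - x) * real q * pi / real M
      = of_int (int q) * pi - of_int x * real q * pi / real M"
    using assms by (simp add: field_simps)
  then show ?thesis
    by (simp add: cos_diff)
qed

lemma cos_sum_reflect: "M > 0 \<Longrightarrow> cos_sum M b (2 * int M - x) = cos_sum M b x"
  unfolding cos_sum_def by (simp only: cos_period_reflect)

text \<open>The parity cases merge: reflecting single angles at \<open>M\<close> contributes
  \<open>(-1)^q\<close>, so for odd \<open>q\<close> the plus signs of the cosine formula become the
  minus signs of the sine formula.\<close>

lemma fq_eq_cos:
  fixes a b c d :: int and q :: nat
  assumes "M > 0" and sum: "a + b + c + d = 2 * int M"
  defines "C \<equiv> \<lambda>x::int. cos (of_int x * real q * pi / real M)"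
  shows "8 * (- 1) ^ q * fq (2 * M) (int M - a, int M - b, int M - c, int M - d) q
    = C 0 + C (a + b) + C (a + c) + C (a + d) - C a - C b - C c - C d"
proof -
  define \<theta> where "\<theta> x = of_int ((int M - x) * int q) * pi / real (2 * M)" for x
  have "real_of_int (a + b + c + d) = of_int (2 * int M)" using sum by presburger
  then have d: "real_of_int d = 2 * real M - of_int a - of_int b - of_int c" by simp
  \<comment> \<open>The four indices sum to \<open>4M - 2M = 2M\<close>, so the product formulas
    apply with \<open>m = q\<close>.\<close>
  have "\<theta> a + \<theta> b + \<theta> c + \<theta> d = of_int (int q) * pi"
    using assms(1) by (simp add: \<theta>_def d field_simps)
  note prods = prod_cos_of_sum[OF this]
  have single: "cos (2 * \<theta> x) = (- 1) ^ q * C x" for x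
  proof -
    have "2 * \<theta> x = of_int (int M - x) * real q * pi / real M"
      using assms(1) by (simp add: \<theta>_def field_simps)
    then show ?thesis
      using cos_half_period_reflect[OF assms(1), of x q] by (simp add: C_def)
  qed
  have pair: "cos (2 * (\<theta> x + \<theta> y)) = C (x + y)" for x y
  proof -
    have "2 * (\<theta> x + \<theta> y) = of_int (2 * int M - (x + y)) * real q * pi / real M"
      using assms(1) by (simp add: \<theta>_def field_simps)
    then show ?thesis
      using cos_period_reflect[OF assms(1), of "x + y" q] by (simp add: C_def)
  qed
  have "C 0 = 1" by (simp add: C_def)
  then show ?thesis
    using prods unfolding single pair
    by (cases "even q") (simp_all add: fq_def cs_def sn_def \<theta>_def algebra_simps)
qed

lemma psi_eq_cos_sum:
  fixes a b c d :: int
  assumes "M > 0" and "a + b + c + d = 2 * int M"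
  shows "8 * psi (2 * M) (int M - a, int M - b, int M - c, int M - d) v
    = cos_sum M v a + cos_sum M v b + cos_sum M v c + cos_sum M v d
      - cos_sum M v 0 - cos_sum M v (a + b) - cos_sum M v (a + c) - cos_sum M v (a + d)"
proof -
  let ?C = "\<lambda>q x. cos (of_int x * real q * pi / real M)"
  have "8 * psi (2 * M) (int M - a, int M - b, int M - c, int M - d) v
    = - (\<Sum>q = 1..M. v q *
        (8 * (- 1) ^ q * fq (2 * M) (int M - a, int M - b, int M - c, int M - d) q))"
    by (simp add: psi_def sum_distrib_left mult_ac)
  also have "\<dots> = - (\<Sum>q = 1..M. v q * (?C q 0 + ?C q (a + b) + ?C q (a + c) + ?C q (a + d)
      - ?C q a - ?C q b - ?C q c - ?C q d))"
    by (simp only: fq_eq_cos[OF assms])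
  also have "\<dots> = cos_sum M v a + cos_sum M v b + cos_sum M v c + cos_sum M v d
      - cos_sum M v 0 - cos_sum M v (a + b) - cos_sum M v (a + c) - cos_sum M v (a + d)"
    unfolding cos_sum_def by (simp only: distrib_left right_diff_distrib sum.distrib sum_subtractf)
  finally show ?thesis .
qed

section \<open>Orthogonality of cosines\<close>

text \<open>The sum is the real part of a geometric series in a \<open>2M\<close>-th root of
  unity.\<close>

lemma sum_cos_multiples:
  fixes m :: int
  assumes "M > 0"
  shows "(\<Sum>x<2 * M. cos (of_int m * real x * pi / real M))
    = (if 2 * int M dvd m then 2 * real M else 0)"
proof (cases "2 * int M dvd m")
  case True
  then obtain k where k: "m = 2 * int M * k" by blast
  have "cos (of_int m * real x * pi / real M) = 1" for x
  proof -
    have "of_int m * real x * pi / real M = 2 * pi * of_int (k * int x)"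
      using assms by (simp add: k field_simps)
    then show ?thesis using cos_int_2pin[of "k * int x"] by simp
  qed
  with True show ?thesis by simp
next
  case False
  define z where "z = cis (of_int m * pi / real M)"
  have "z \<noteq> 1"
  proof
    assume "z = 1"
    then have "cos (of_int m * pi / real M) = 1" by (simp add: z_def complex_eq_iff)
    then obtain k :: int where "of_int m * pi / real M = of_int k * 2 * pi"
      unfolding cos_one_2pi_int by blast
    then have "real_of_int m = of_int (2 * int M * k)"
      using assms by (simp add: field_simps)
    then have "m = 2 * int M * k" by linarith
    with False show False by simp
  qed
  moreover have "z ^ (2 * M) = 1"
  proof -
    have "z ^ (2 * M) = cis (2 * pi * of_int m)"
      using assms unfolding z_def by (simp add: DeMoivre mult_ac)
    then show ?thesis by simp
  qed
  ultimately have "(\<Sum>x<2 * M. z ^ x) = 0"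
    by (simp add: geometric_sum)
  then have "Re (\<Sum>x<2 * M. z ^ x) = 0" by simp
  then show ?thesis
    using False by (simp add: z_def DeMoivre mult_ac)
qed

text \<open>Orthogonality of the cosines, under which the constant is annihilated because the
  frequency \<open>0\<close> does not occur in \<^const>\<open>cos_sum\<close>.\<close>

lemma cos_sum_const_imp_zero:
  assumes "M > 0" and const: "\<And>x. x < 2 * M \<Longrightarrow> cos_sum M b (int x) = a"
    and r: "r \<in> {1..M}"
  shows "b r = 0"
proof -
  let ?C = "\<lambda>m x. cos (of_int m * real x * pi / real M)"
  have orth: "(\<Sum>x<2 * M. ?C (int q) x * ?C (int r) x)
      = (if q = r then if r = M then 2 * real M else real M else 0)" if "q \<in> {1..M}" for q
  proof -
    have "?C (int q) x * ?C (int r) x = (?C (int q - int r) x + ?C (int q + int r) x) / 2" for x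
      by (simp add: cos_times_cos ring_distribs add_divide_distrib diff_divide_distrib)
    then have "(\<Sum>x<2 * M. ?C (int q) x * ?C (int r) x)
      = ((\<Sum>x<2 * M. ?C (int q - int r) x) + (\<Sum>x<2 * M. ?C (int q + int r) x)) / 2"
      by (simp only: sum.distrib sum_divide_distrib[symmetric])
    moreover have "2 * int M dvd int q - int r \<longleftrightarrow> q = r"
    proof
      assume "2 * int M dvd int q - int r"
      then show "q = r" using that r zdvd_imp_le
        by (smt (verit, ccfv_threshold) atLeastAtMost_iff dvd_diff_commute of_nat_le_iff of_nat_1 nat_int)
    qed simp
    \<comment> \<open>Since \<open>q + r\<close> is at most \<open>2M\<close>, only the top
      frequency \<open>M\<close> gets a second contribution, hence its norm \<open>2M\<close>
      instead of \<open>M\<close>.\<close>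
    moreover have "2 * int M dvd int q + int r \<longleftrightarrow> q = M \<and> r = M"
    proof
      assume "2 * int M dvd int q + int r"
      then have "2 * int M \<le> int q + int r" using that r by (intro zdvd_imp_le) auto
      then show "q = M \<and> r = M" using that r by auto
    qed simp
    ultimately show ?thesis
      unfolding sum_cos_multiples[OF assms(1)] by auto
  qed
  have "\<not> 2 * int M dvd int r"
    using r zdvd_imp_le[of "2 * int M" "int r"] by auto
  then have "0 = a * (\<Sum>x<2 * M. ?C (int r) x)"
    by (simp only: sum_cos_multiples[OF assms(1)]) simp
  also have "\<dots> = (\<Sum>x<2 * M. cos_sum M b (int x) * ?C (int r) x)"
    by (simp add: const sum_distrib_left)
  also have "\<dots> = (\<Sum>x<2 * M. \<Sum>q = 1..M. b q * (?C (int q) x * ?C (int r) x))"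
    unfolding cos_sum_def sum_distrib_right by (intro sum.cong refl) (simp add: mult_ac)
  also have "\<dots> = (\<Sum>q = 1..M. b q * (\<Sum>x<2 * M. ?C (int q) x * ?C (int r) x))"
    by (subst sum.swap) (simp add: sum_distrib_left)
  also have "\<dots> = (\<Sum>q = 1..M. if q = r then b r * (if r = M then 2 * real M else real M) else 0)"
    by (intro sum.cong refl, subst orth) auto
  also have "\<dots> = b r * (if r = M then 2 * real M else real M)"
    using r by simp
  finally show ?thesis using assms(1) by (simp split: if_splits)
qed

section \<open>Second differences and the quadratic form of solutions\<close>

lemma quadratic_of_second_differences:
  fixes A :: "int \<Rightarrow> real" and K :: int
  assumes "K \<ge> 1" and reflect: "\<And>x. A (4 * K - x) = A x"
    and E1: "\<And>n. 1 \<le> n \<Longrightarrow> n \<le> K - 1 \<Longrightarrow>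
      A (n + 1) + A (2*K - n) + A (2*K - 1) + A 0 = A (2*K) + A (2*K - n - 1) + A n + A 1"
    and E2: "\<And>m. m = 1 \<or> 3 \<le> m \<and> m \<le> K + 1 \<Longrightarrow>
      A 0 + A 2 + 2 * A (2*K + 1 - m) = A (2*K + 2 - m) + A (2*K - m) + 2 * A 1"
    and x: "0 \<le> x" "x \<le> 4 * K"
  shows "A x = A 0 - (A 0 - 2 * A 1 + A 2) / 2 * of_int (x * (4 * K - x))"
proof -
  define \<gamma> where "\<gamma> = A 0 - 2 * A 1 + A 2"
  define D where "D p = A (p + 1) - 2 * A p + A (p - 1)" for p
  have D_reflect: "D (4*K - p) = D p" for p
    using reflect[of p] reflect[of "p - 1"] reflect[of "p + 1"]
    by (simp add: D_def algebra_simps)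
  have D_swap: "D p = D (2*K - p)" if "1 \<le> p" "p \<le> K - 1" for p
  proof (cases "p = 1")
    case True
    with E1[of p] that show ?thesis by (simp add: D_def)
  next
    case False
    \<comment> \<open>Subtracting consecutive equations turns \<open>E1\<close> into a symmetry of
      second differences about \<open>K\<close>.\<close>
    with E1[of p] E1[of "p - 1"] that show ?thesis by (simp add: D_def algebra_simps)
  qed
  \<comment> \<open>\<open>E2\<close> at \<open>m\<close> says
    \<open>D (2K + 1 - m) = \<gamma>\<close>; the omitted \<open>m = 2\<close> leaves the gap at
    \<open>2K - 1\<close>.\<close>
  have D_high: "D p = \<gamma>" if "p = 2*K \<or> K \<le> p \<and> p \<le> 2*K - 2" for p
    using E2[of "2*K + 1 - p"] that by (auto simp: D_def \<gamma>_def algebra_simps)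
  have D_1: "D 1 = \<gamma>" by (simp add: D_def \<gamma>_def)
  have D_half: "D p = \<gamma>" if p: "1 \<le> p" "p \<le> 2*K" for p
  proof -
    consider "p = 1" | "p = 2*K - 1" "K \<ge> 2" | "2 \<le> p" "p \<le> K - 1"
      | "p = 2*K \<or> K \<le> p \<and> p \<le> 2*K - 2"
      using p assms(1) by linarith
    then show ?thesis
    proof cases
      case 2
      \<comment> \<open>The gap is filled by its mirror image \<open>D 1\<close>, equal to
        \<open>\<gamma>\<close> by definition.\<close>
      with D_swap[of 1] D_1 show ?thesis by simp
    next
      case 3
      with D_swap[of p] D_high[of "2*K - p"] show ?thesis by simp
    qed (use D_1 D_high in auto)
  qed
  have D_all: "D p = \<gamma>" if "1 \<le> p" "p \<le> 4*K - 1" for p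
    using D_half[of p] D_half[of "4*K - p"] D_reflect[of p] that by linarith
  \<comment> \<open>\<open>x (4K - x)\<close> has second difference \<open>-2\<close>, so the
    correction makes all second differences of \<open>G\<close> vanish.\<close>
  define G where "G x = A x - A 0 + \<gamma> / 2 * of_int (x * (4*K - x))" for x
  have G_step: "G (p + 1) = 2 * G p - G (p - 1)" if "1 \<le> p" "p \<le> 4*K - 1" for p
    using D_all[OF that] by (simp add: D_def G_def field_simps)
  have G_lin: "int n \<le> 4*K \<Longrightarrow> G (int n) = real n * G 1" for n
  proof (induction n rule: less_induct)
    case (less n)
    consider "n = 0" | "n = 1" | k where "n = Suc (Suc k)" by (metis One_nat_def not0_implies_Suc)
    then show ?case
    proof cases
      case 3
      then show ?thesis
        using less.IH[of k] less.IH[of "Suc k"] G_step[of "int k + 1"] less.prems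
        by (simp add: algebra_simps)
    qed (simp_all add: G_def)
  qed
  \<comment> \<open>A linear \<open>G\<close> that vanishes at both \<open>0\<close> and
    \<open>4K\<close> has slope zero.\<close>
  have "G (4*K) = 0" using reflect[of 0] by (simp add: G_def)
  then have "G 1 = 0" using G_lin[of "nat (4*K)"] assms(1) by simp
  then have "G x = 0" using G_lin[of "nat x"] x by simp
  then show ?thesis by (simp add: G_def \<gamma>_def)
qed

lemma linear_psi: "Vector_Spaces.linear fun_scale (*) (psi N t)"
  by unfold_locales
    (simp_all add: psi_def fun_scale_def algebra_simps sum.distrib sum_distrib_left)

lemma linear_cos_sum_second_difference:
  "Vector_Spaces.linear fun_scale (*) (\<lambda>b. cos_sum M b 0 - 2 * cos_sum M b 1 + cos_sum M b 2)"
  by unfold_locales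
    (simp_all add: cos_sum_def fun_scale_def algebra_simps sum.distrib sum_distrib_left)

section \<open>Consequences for solutions of the equations\<close>

lemma cos_sum_quadratic:
  assumes "K > 0"
    and sol: "\<And>t. t \<in> S1 (2 * (2 * K)) \<union> S2 (2 * (2 * K)) \<Longrightarrow> psi (2 * (2 * K)) t b = 0"
    and x: "0 \<le> x" "x \<le> 4 * int K"
  defines "A \<equiv> cos_sum (2 * K) b"
  shows "A x = A 0 - (A 0 - 2 * A 1 + A 2) / 2 * of_int (x * (4 * int K - x))"
proof (rule quadratic_of_second_differences[OF _ _ _ _ x])
  have M: "2 * K > 0" using assms(1) by simp
  note psi_eq = psi_eq_cos_sum[OF M, of _ _ _ _ b, folded A_def]
  show reflect: "A (4 * int K - y) = A y" for y
    using cos_sum_reflect[OF M, of b y] by (simp add: A_def)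
  show "1 \<le> int K" using assms(1) by simp
  show "A (n + 1) + A (2 * int K - n) + A (2 * int K - 1) + A 0
      = A (2 * int K) + A (2 * int K - n - 1) + A n + A 1" if n: "1 \<le> n" "n \<le> int K - 1" for n
  proof -
    have "(0, n + 1, 2 * int K - n, 2 * int K - 1) \<in> S1 (2 * (2 * K))"
      using n by (auto simp: S1_def)
    then have "psi (2 * (2 * K)) (0, n + 1, 2 * int K - n, 2 * int K - 1) b = 0"
      using sol by blast
    \<comment> \<open>The arguments are \<open>2K\<close> minus the indices; reflection folds the
      pair sums to \<open>n + 1\<close>, \<open>2K - n\<close>, \<open>2K - 1\<close>.\<close>
    then show ?thesis
      using psi_eq[of "2 * int K" "2 * int K - n - 1" n 1]
        reflect[of "n + 1"] reflect[of "2 * int K - n"] reflect[of "2 * int K - 1"]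
      by (simp add: algebra_simps)
  qed
  show "A 0 + A 2 + 2 * A (2 * int K + 1 - m) = A (2 * int K + 2 - m) + A (2 * int K - m) + 2 * A 1"
    if m: "m = 1 \<or> 3 \<le> m \<and> m \<le> int K + 1" for m
  proof -
    have "(2 - m, m, 2 * int K - 1, 2 * int K - 1) \<in> S2 (2 * (2 * K))"
      using m by (auto simp: S2_def)
    then have "psi (2 * (2 * K)) (2 - m, m, 2 * int K - 1, 2 * int K - 1) b = 0"
      using sol by blast
    \<comment> \<open>Here \<open>c = d = 1\<close> makes two pair sums coincide, which gives the
      factor 2.\<close>
    then show ?thesis
      using psi_eq[of "2 * int K + m - 2" "2 * int K - m" 1 1]
        reflect[of 2] reflect[of "2 * int K + 1 - m"] reflect[of "2 * int K + 2 - m"]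
      by (simp add: algebra_simps)
  qed
qed

lemma psi_zero_on_S:
  assumes "K > 0"
    and sol: "\<And>t. t \<in> S1 (2 * (2 * K)) \<union> S2 (2 * (2 * K)) \<Longrightarrow> psi (2 * (2 * K)) t v = 0"
    and "t \<in> S (2 * (2 * K))"
  shows "psi (2 * (2 * K)) t v = 0"
proof -
  obtain i j k l where t: "t = (i, j, k, l)" by (cases t)
  define a b c d where "a = 2 * int K - i" "b = 2 * int K - j" "c = 2 * int K - k" "d = 2 * int K - l"
  note abcd = this
  \<comment> \<open>The index bound of \<open>S\<close> makes all four at least 1, so every argument
    below lies in the range of the quadratic formula.\<close>
  have pos: "a \<ge> 1" "b \<ge> 1" "c \<ge> 1" "d \<ge> 1" and sum: "a + b + c + d = 4 * int K"
    using assms(3) by (auto simp: t S_def Nh_def abcd)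
  have d: "d = 4 * int K - a - b - c" using sum by simp
  have M: "2 * K > 0" using assms(1) by simp
  define A where "A = cos_sum (2 * K) v"
  define \<gamma> where "\<gamma> = A 0 - 2 * A 1 + A 2"
  have quad: "A x = A 0 - \<gamma> / 2 * of_int (x * (4 * int K - x))" if "0 \<le> x" "x \<le> 4 * int K" for x
    using cos_sum_quadratic[OF assms(1) sol that] by (simp add: A_def \<gamma>_def)
  have "8 * psi (2 * (2 * K)) (2 * int K - a, 2 * int K - b, 2 * int K - c, 2 * int K - d) v
    = A a + A b + A c + A d - A 0 - A (a + b) - A (a + c) - A (a + d)"
    using psi_eq_cos_sum[OF M, of a b c d v] sum by (simp add: A_def)
  also have "\<dots> = 0"
  proof -
    define P where "P x = x * (4 * int K - x)" for x
    \<comment> \<open>As \<open>4K = a + b + c + d\<close>, both sides are twice the sum of products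
      of two distinct variables.\<close>
    have "P a + P b + P c + P d = P (a + b) + P (a + c) + P (a + d)"
      unfolding P_def d by (simp add: algebra_simps)
    then have "real_of_int (P a) + of_int (P b) + of_int (P c) + of_int (P d)
        = of_int (P (a + b)) + of_int (P (a + c)) + of_int (P (a + d))"
      by (metis of_int_add)
    then have "\<gamma> / 2 * of_int (P a) + \<gamma> / 2 * of_int (P b)
        + \<gamma> / 2 * of_int (P c) + \<gamma> / 2 * of_int (P d)
        = \<gamma> / 2 * of_int (P (a + b)) + \<gamma> / 2 * of_int (P (a + c))
        + \<gamma> / 2 * of_int (P (a + d))"
      by (metis distrib_left)
    moreover have "A x = A 0 - \<gamma> / 2 * of_int (P x)"
      if "x \<in> {a, b, c, d, a + b, a + c, a + d}" for x
      unfolding P_def by (rule quad) (use that pos sum in auto)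
    ultimately show ?thesis by simp
  qed
  finally show ?thesis by (simp add: t abcd)
qed

lemma second_difference_zero_imp_zero:
  assumes "K > 0" and "b \<in> coord_space (2 * K)"
    and sol: "\<And>t. t \<in> S1 (2 * (2 * K)) \<union> S2 (2 * (2 * K)) \<Longrightarrow> psi (2 * (2 * K)) t b = 0"
    and "cos_sum (2 * K) b 0 - 2 * cos_sum (2 * K) b 1 + cos_sum (2 * K) b 2 = 0"
  shows "b = 0"
proof -
  have "cos_sum (2 * K) b (int x) = cos_sum (2 * K) b 0" if "x < 2 * (2 * K)" for x
    using cos_sum_quadratic[OF assms(1) sol, of "int x"] assms(4) that by simp
  then have "b r = 0" if "r \<in> {1..2 * K}" for r
    using cos_sum_const_imp_zero[of "2 * K" b "cos_sum (2 * K) b 0" r] assms(1) that by simp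
  then show ?thesis using assms(2) by (auto simp: coord_space_def fun_eq_iff)
qed

section \<open>Counting the equations and independence\<close>

lemma finite_card_S1_Un_S2:
  assumes "K > 0"
  shows "finite (S1 (2 * (2 * K)) \<union> S2 (2 * (2 * K)))"
    and "card (S1 (2 * (2 * K)) \<union> S2 (2 * (2 * K))) = 2 * K - 1"
proof -
  let ?f = "\<lambda>n. (0 :: int, n + 1, 2 * int K - n, 2 * int K - 1)"
  let ?g = "\<lambda>m. (2 - m, m, 2 * int K - 1, 2 * int K - 1)"
  have S1: "S1 (2 * (2 * K)) = ?f ` {1..int K - 1}"
    by (auto simp: S1_def)
  have S2: "S2 (2 * (2 * K)) = ?g ` insert 1 {3..int K + 1}"
    by (auto simp: S2_def)
  have fin: "finite (S1 (2 * (2 * K)))" "finite (S2 (2 * (2 * K)))"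
    unfolding S1 S2 by simp_all
  have "card (S1 (2 * (2 * K))) = K - 1"
    unfolding S1 by (subst card_image) (auto simp: inj_on_def)
  moreover have "card (S2 (2 * (2 * K))) = K"
    unfolding S2 using assms by (subst card_image) (auto simp: inj_on_def)
  \<comment> \<open>A first entry 0 in \<open>S2\<close> would require the skipped value
    \<open>m = 2\<close>, whose quadruple is that of \<open>n = 1\<close> in the first
    family.\<close>
  moreover have "S1 (2 * (2 * K)) \<inter> S2 (2 * (2 * K)) = {}"
    unfolding S1 S2 by auto
  ultimately show "card (S1 (2 * (2 * K)) \<union> S2 (2 * (2 * K))) = 2 * K - 1"
    using assms fin by (subst card_Un_disjoint) auto
  show "finite (S1 (2 * (2 * K)) \<union> S2 (2 * (2 * K)))" using fin by simp
qed

text \<open>Trading one equation for the vanishing of the second difference leaves fewer equations than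
  unknowns; a nonzero solution of the new system cannot satisfy the discarded equation.\<close>

lemma psi_separated:
  assumes "K > 0" and t: "t \<in> S1 (2 * (2 * K)) \<union> S2 (2 * (2 * K))" (is "t \<in> ?T")
  shows "\<exists>b\<in>coord_space (2 * K). psi (2 * (2 * K)) t b \<noteq> 0
    \<and> (\<forall>s\<in>?T - {t}. psi (2 * (2 * K)) s b = 0)"
proof -
  define F where "F s = (if s = t
    then \<lambda>b. cos_sum (2 * K) b 0 - 2 * cos_sum (2 * K) b 1 + cos_sum (2 * K) b 2
    else psi (2 * (2 * K)) s)" for s
  have "Vector_Spaces.linear fun_scale (*) (F s)" for s
    by (simp add: F_def linear_psi linear_cos_sum_second_difference)
  moreover have "card ?T < card {1..2 * K}" "finite ?T"
    using finite_card_S1_Un_S2[OF assms(1)] assms(1) by auto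
  ultimately obtain b where b: "\<forall>q. q \<notin> {1..2 * K} \<longrightarrow> b q = 0" "b \<noteq> 0" "\<forall>s\<in>?T. F s b = 0"
    using homogeneous_system_nontrivial_solution[of ?T "{1..2 * K}" F] by blast
  have coord: "b \<in> coord_space (2 * K)" using b(1) unfolding coord_space_def by blast
  have rest: "psi (2 * (2 * K)) s b = 0" if "s \<in> ?T - {t}" for s
    using b(3) that by (metis DiffD1 DiffD2 F_def singletonI)
  have "psi (2 * (2 * K)) t b \<noteq> 0"
  proof
    assume "psi (2 * (2 * K)) t b = 0"
    then have "psi (2 * (2 * K)) s b = 0" if "s \<in> ?T" for s
      using rest that by blast
    moreover have "F t b = 0" using b(3) t by blast
    then have "cos_sum (2 * K) b 0 - 2 * cos_sum (2 * K) b 1 + cos_sum (2 * K) b 2 = 0"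
      by (simp add: F_def)
    ultimately show False
      using second_difference_zero_imp_zero[OF assms(1) coord] b(2) by blast
  qed
  with coord rest show ?thesis by blast
qed

theorem lemma5:
  fixes N :: nat
  assumes "N > 0" and "4 dvd N"
  shows "(\<forall>t \<in> S1 N \<union> S2 N. Vector_Spaces.linear fun_scale (*) (psi N t))
    \<and> card (S1 N \<union> S2 N) = N div 2 - 1
    \<and> inj_on (psi_functional N) (S1 N \<union> S2 N)
    \<and> fun_space.independent (psi_functional N ` (S1 N \<union> S2 N))
    \<and> (\<exists>b \<in> coord_space (N div 2). b \<noteq> 0 \<and> (\<forall>t \<in> S1 N \<union> S2 N. psi N t b = 0))
    \<and> (\<forall>b \<in> coord_space (N div 2). b \<noteq> 0 \<and> (\<forall>t \<in> S1 N \<union> S2 N. psi N t b = 0)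
          \<longrightarrow> (\<forall>t \<in> S N. psi N t b = 0))"
proof -
  obtain K where N: "N = 2 * (2 * K)" using assms(2) by (auto elim!: dvdE)
  with assms(1) have K: "K > 0" by simp
  have half: "N div 2 = 2 * K" by (simp add: N)
  let ?T = "S1 N \<union> S2 N"
  note fin = finite_card_S1_Un_S2[OF K, folded N]
  \<comment> \<open>The separating vectors lie in \<open>coord_space\<close>, where
    \<open>psi_functional\<close> agrees with \<open>psi\<close>.\<close>
  have "\<exists>b. psi_functional N t b \<noteq> 0 \<and> (\<forall>s\<in>?T - {t}. psi_functional N s b = 0)"
    if "t \<in> ?T" for t
    using psi_separated[OF K, of t, folded N] that by (fastforce simp: psi_functional_def half)
  then have indep: "inj_on (psi_functional N) ?T \<and> fun_space.independent (psi_functional N ` ?T)"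
    by (rule independent_if_separated[OF fin(1)])
  \<comment> \<open>There are \<open>2K - 1\<close> equations for \<open>2K\<close>
    unknowns.\<close>
  have "card ?T < card {1..2 * K}" using fin(2) K by simp
  then obtain b where b: "\<forall>q. q \<notin> {1..2 * K} \<longrightarrow> b q = 0" "b \<noteq> 0" "\<forall>s\<in>?T. psi N s b = 0"
    using homogeneous_system_nontrivial_solution[of ?T "{1..2 * K}" "psi N"] fin(1) linear_psi by blast
  have "b \<in> coord_space (N div 2)" using b(1) unfolding coord_space_def half by blast
  with b have ex: "\<exists>b\<in>coord_space (N div 2). b \<noteq> 0 \<and> (\<forall>t\<in>?T. psi N t b = 0)" by blast
  have "\<forall>t\<in>S N. psi N t b = 0" if "\<forall>t\<in>?T. psi N t b = 0" for b
    using psi_zero_on_S[OF K, of b, folded N] that by blast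
  with indep ex fin(2) linear_psi show ?thesis unfolding half by blast
qed

end
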